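(* Let $(X,d)$ be a metric space. Given maps $T_1,\dots,T_m:X\to X$, define the set-valued map $T$ from $X$ to subsets of $X$ by $T(x)=\{T_1(x),\dots,T_m(x)\}$, and let $\{x_n\}_{n\in\mathbb{Z}_{\ge0}}$ be an evolution of $T$. Assume that: (i) there exists a compact set $W\subseteq X$ that is strongly positively invariant for $T$; (ii) there exists a function $U:W\to\mathbb{R}$ such that $U(w')<U(w)$ for all $w\in W$ and $w'\in T(w)\setminus\{w\}$; (iii) the maps $T_i$, for $i\in\{1,\dots,m\}$, and $U$ are continuous on $W$; and (iv) for all $i\in\{1,\dots,m\}$ there exists an increasing sequence of times $\{n_k\}_{k\in\mathbb{Z}_{\ge0}}$ such that $x_{n_k+1}=T_i(x_{n_k})$ for all $k$ and $(n_{k+1}-n_k)$ is bounded. If $x_0\in W$, then there exists $c\in\mathbb{R}$ such that the evolution $\{x_n\}_{n\in\mathbb{Z}_{\ge0}}$ approaches the set $$(F_1\cap\cdots\cap F_m)\cap U^{-1}(c),$$ where $F_i=\{w\in W\mid T_i(w)=w\}$ is the set of fixed points of $T_i$ in $W$, $i\in\{1,\dots,m\}$.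
   Context: An evolution of a set-valued map $T$ is a sequence $\{x_n\}_{n\in\mathbb{Z}_{\ge0}}\subset X$ with $x_{n+1}\in T(x_n)$ for all $n$. A set $W\subset X$ is strongly positively invariant for $T$ if $T(w)\subset W$ for all $w\in W$. A sequence $\{x_n\}$ approaches a set $S$ if $\inf_{s\in S} d(x_n,s)\to0$ as $n\to\infty$. *)

theory Defs
  imports "HOL-Analysis.Analysis"
begin

definition set_valued :: "nat \<Rightarrow> (nat \<Rightarrow> 'a \<Rightarrow> 'a) \<Rightarrow> 'a \<Rightarrow> 'a set" where
  "set_valued m T x = (\<lambda>i. T i x) ` {1..m}"

definition evolution :: "('a \<Rightarrow> 'a set) \<Rightarrow> (nat \<Rightarrow> 'a) \<Rightarrow> bool" where
  "evolution TT x \<longleftrightarrow> (\<forall>n. x (Suc n) \<in> TT (x n))"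

definition strongly_positively_invariant :: "('a \<Rightarrow> 'a set) \<Rightarrow> 'a set \<Rightarrow> bool" where
  "strongly_positively_invariant TT W \<longleftrightarrow> (\<forall>w\<in>W. TT w \<subseteq> W)"

(* infdist to the empty set is 0 in the library, whereas the infimum over the
   empty set is infinite; hence no sequence approaches the empty set. *)
definition approaches :: "(nat \<Rightarrow> 'a::metric_space) \<Rightarrow> 'a set \<Rightarrow> bool" where
  "approaches x S \<longleftrightarrow> S \<noteq> {} \<and> (\<lambda>n. infdist (x n) S) \<longlonglongrightarrow> 0"

definition fixed_points_in :: "'a set \<Rightarrow> ('a \<Rightarrow> 'a) \<Rightarrow> 'a set" where
  "fixed_points_in W f = {w \<in> W. f w = w}"

end

theory Submission
  imports Defs
begin

text \<open>
  Along the evolution \<open>U\<close> decreases to a limit \<open>c\<close>.  If points at which \<open>T\<^sub>i\<close> is applied accumulate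
  at \<open>p\<close>, then \<open>U (T\<^sub>i p) = c = U p\<close>, so \<open>p\<close> is fixed by \<open>T\<^sub>i\<close>.  By compactness, consecutive points
  of the evolution become arbitrarily close.  Since every \<open>T\<^sub>i\<close> is applied with bounded gaps, each
  accumulation point of the evolution is also an accumulation point of times at which \<open>T\<^sub>i\<close> is
  applied, for every \<open>i\<close>, and hence is a common fixed point.
\<close>

text \<open>The times satisfying \<open>P\<close> form an infinite set; sequential compactness is
  applied to \<open>x\<close> along its increasing enumeration. This turns the failure of an
  eventual property into a convergent subsequence of counterexamples.\<close>

lemma frequently_convergent_subseq:
  fixes x :: "nat \<Rightarrow> 'a::metric_space"
  assumes "compact W" "range x \<subseteq> W" "\<exists>\<^sub>F n in sequentially. P n"
  obtains p and r :: "nat \<Rightarrow> nat" where "p \<in> W" "strict_mono r" "(\<lambda>k. x (r k)) \<longlonglongrightarrow> p" "\<forall>k. P (r k)"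
proof -
  have inf: "infinite {n. P n}"
    using assms(3) by (simp add: frequently_cofinite flip: cofinite_eq_sequentially)
  define e where "e = enumerate {n. P n}"
  have e: "strict_mono e" "\<And>k. P (e k)"
    using strict_mono_enumerate[OF inf] enumerate_in_set[OF inf] by (auto simp: e_def)
  obtain p q where pq: "p \<in> W" "strict_mono q" "((x \<circ> e) \<circ> q) \<longlonglongrightarrow> p"
    using seq_compactE[OF assms(1)[unfolded compact_eq_seq_compact_metric], of "x \<circ> e"] assms(2)
    by (metis comp_apply rangeI subsetD)
  show thesis
    by (rule that[of p "e \<circ> q"]) (use e pq in \<open>auto intro: strict_monoI strict_monoD simp: comp_def\<close>)
qed

text \<open>Otherwise infinitely many terms keep a distance at least \<open>e\<close> from
  \<open>S\<close>; by compactness some of them converge, and their limit lies in \<open>S\<close>,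
  which is absurd.\<close>

lemma compact_infdist_tendsto_0:
  fixes x :: "nat \<Rightarrow> 'a::metric_space"
  assumes "compact W" "range x \<subseteq> W"
    and "\<And>p r. strict_mono r \<Longrightarrow> (\<lambda>k. x (r k)) \<longlonglongrightarrow> p \<Longrightarrow> p \<in> S"
  shows "(\<lambda>n. infdist (x n) S) \<longlonglongrightarrow> 0"
proof (rule ccontr)
  assume "\<not> ?thesis"
  then obtain e where e: "e > 0" "\<exists>\<^sub>F n in sequentially. \<not> infdist (x n) S < e"
    by (auto simp: tendsto_iff not_eventually infdist_nonneg)
  obtain p r where "p \<in> W" and r: "strict_mono r" "(\<lambda>k. x (r k)) \<longlonglongrightarrow> p"
    and far: "\<forall>k. \<not> infdist (x (r k)) S < e"
    using frequently_convergent_subseq[OF assms(1,2) e(2)] by blast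
  have "p \<in> S"
    using assms(3) r by blast
  then have "(\<lambda>k. infdist (x (r k)) S) \<longlonglongrightarrow> 0"
    using tendsto_infdist[OF r(2), of S] by simp
  then have "\<forall>\<^sub>F k in sequentially. infdist (x (r k)) S < e"
    using e(1) by (rule order_tendstoD)
  then show False
    using far by simp
qed

text \<open>The first term reaching \<open>N\<close> overshoots by at most \<open>B\<close>, since
  its predecessor lies below \<open>N\<close>; if it has no predecessor it is \<open>n 0\<close>,
  hence that summand. What matters later is that the window length does not depend on
  \<open>N\<close>.\<close>

lemma bounded_gaps_ex:
  fixes n :: "nat \<Rightarrow> nat"
  assumes "strict_mono n" "\<And>k. n (Suc k) - n k \<le> B"
  shows "\<exists>k. N \<le> n k \<and> n k \<le> N + (n 0 + B)"
proof -
  define k where "k = (LEAST k. N \<le> n k)"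
  have k: "N \<le> n k"
    unfolding k_def using seq_suble[OF assms(1)] by (rule LeastI)
  have "n k \<le> N + (n 0 + B)"
  proof (cases k)
    case (Suc l)
    then have "n l < N"
      using not_less_Least[of l "\<lambda>k. N \<le> n k"] by (simp add: k_def)
    then show ?thesis
      using assms(2)[of l] Suc by simp
  qed simp
  with k show ?thesis by blast
qed

lemma dist_shift_tendsto_0:
  fixes x :: "nat \<Rightarrow> 'a::metric_space"
  assumes "(\<lambda>n. dist (x (Suc n)) (x n)) \<longlonglongrightarrow> 0"
  shows "(\<lambda>n. dist (x (n + k)) (x n)) \<longlonglongrightarrow> 0"
proof (induction k)
  case (Suc k)
  have "(\<lambda>n. dist (x (Suc (n + k))) (x (n + k)) + dist (x (n + k)) (x n)) \<longlonglongrightarrow> 0"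
    by (intro tendsto_add_zero Suc LIMSEQ_ignore_initial_segment[OF assms])
  then show ?case
    by (rule Lim_null_comparison[rotated]) (simp add: dist_triangle)
qed simp

lemma tendsto_bounded_perturbation:
  fixes x :: "nat \<Rightarrow> 'a::metric_space" and r s :: "nat \<Rightarrow> nat"
  assumes step: "(\<lambda>n. dist (x (Suc n)) (x n)) \<longlonglongrightarrow> 0"
    and r: "filterlim r at_top sequentially" "(\<lambda>k. x (r k)) \<longlonglongrightarrow> p"
    and s: "\<And>k. r k \<le> s k" "\<And>k. s k \<le> r k + K"
  shows "(\<lambda>k. x (s k)) \<longlonglongrightarrow> p"
proof -
  \<comment> \<open>The offset \<open>s k - r k\<close> may vary with \<open>k\<close> but takes
    only the values 0 to \<open>K\<close>. Summing over all of them gives a single null sequence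
    that dominates every case.\<close>
  define D where "D n = (\<Sum>j\<le>K. dist (x (n + j)) (x n))" for n
  have "D \<longlonglongrightarrow> (\<Sum>j\<le>K. 0)"
    unfolding D_def by (intro tendsto_sum dist_shift_tendsto_0 step)
  then have "(\<lambda>k. D (r k)) \<longlonglongrightarrow> 0"
    using filterlim_compose[OF _ r(1)] by simp
  moreover have "(\<lambda>k. dist (x (r k)) p) \<longlonglongrightarrow> 0"
    using r(2) by (rule tendsto_dist_iff[THEN iffD1])
  ultimately have lim: "(\<lambda>k. D (r k) + dist (x (r k)) p) \<longlonglongrightarrow> 0"
    by (rule tendsto_add_zero)
  have "dist (x (s k)) p \<le> D (r k) + dist (x (r k)) p" for k
  proof -
    have "dist (x (r k + (s k - r k))) (x (r k)) \<le> D (r k)"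
      unfolding D_def by (rule member_le_sum) (use s[of k] in auto)
    then show ?thesis
      using s(1)[of k] dist_triangle[of "x (s k)" p "x (r k)"] by simp
  qed
  then have "(\<lambda>k. dist (x (s k)) p) \<longlonglongrightarrow> 0"
    by (intro Lim_null_comparison[OF _ lim]) simp
  then show ?thesis
    by (rule tendsto_dist_iff[THEN iffD2])
qed

theorem theorem4p3:
  fixes T :: "nat \<Rightarrow> 'a::metric_space \<Rightarrow> 'a"
    and m :: nat
    and x :: "nat \<Rightarrow> 'a"
    and W :: "'a set"
    and U :: "'a \<Rightarrow> real"
  assumes "evolution (set_valued m T) x"
    and "compact W"
    and "strongly_positively_invariant (set_valued m T) W"
    and "\<forall>w\<in>W. \<forall>w'\<in>set_valued m T w - {w}. U w' < U w"
    and "\<forall>i\<in>{1..m}. continuous_on W (T i)"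
    and "continuous_on W U"
    and "\<forall>i\<in>{1..m}. \<exists>n :: nat \<Rightarrow> nat. strict_mono n
           \<and> (\<forall>k. x (Suc (n k)) = T i (x (n k)))
           \<and> (\<exists>B. \<forall>k. n (Suc k) - n k \<le> B)"
    and "x 0 \<in> W"
  shows "\<exists>c. approaches x ((\<Inter>i\<in>{1..m}. fixed_points_in W (T i)) \<inter> {w \<in> W. U w = c})"
proof -
  have evol: "\<exists>i\<in>{1..m}. x (Suc n) = T i (x n)" for n
    using assms(1) by (auto simp: evolution_def set_valued_def)
  have inv: "T i w \<in> W" if "i \<in> {1..m}" "w \<in> W" for i w
    using assms(3) that unfolding strongly_positively_invariant_def set_valued_def by blast
  have strict: "U (T i w) < U w" if "i \<in> {1..m}" "w \<in> W" "T i w \<noteq> w" for i w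
    using assms(4) that by (auto simp: set_valued_def)
  have xW: "x n \<in> W" for n
  proof (induction n)
    case (Suc n)
    then show ?case
      using evol[of n] inv by auto
  qed (rule assms(8))
  then have ran: "range x \<subseteq> W"
    by blast
  \<comment> \<open>Equality occurs when the applied map fixes \<open>x n\<close>; otherwise the
    decrease is strict.\<close>
  have "U (x (Suc n)) \<le> U (x n)" for n
    using evol[of n] strict[OF _ xW[of n]] by fastforce
  then have "decseq (\<lambda>n. U (x n))"
    by (rule decseq_SucI)
  moreover have "bdd_below (U ` W)"
    using assms(2,6) by (simp add: compact_continuous_image compact_imp_bounded bounded_imp_bdd_below)
  then obtain b where "\<And>n. b \<le> U (x n)"
    using xW by (auto simp: bdd_below_def)
  ultimately obtain c where c: "(\<lambda>n. U (x n)) \<longlonglongrightarrow> c"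
    using decseq_convergent by metis
  \<comment> \<open>Divergence of \<open>r\<close> suffices here. Strict monotonicity is not assumed
    because the claim will also serve for times chosen near a subsequence, which may repeat.\<close>
  have Ulim: "U p = c"
    if "filterlim r at_top sequentially" "(\<lambda>k. x (r k)) \<longlonglongrightarrow> p" "p \<in> W" for r p
  proof -
    have "(\<lambda>k. U (x (r k))) \<longlonglongrightarrow> U p"
      using continuous_on_tendsto_compose[OF assms(6) that(2,3)] xW by simp
    with filterlim_compose[OF c that(1)] show ?thesis
      by (rule LIMSEQ_unique[THEN sym])
  qed
  \<comment> \<open>\<open>Ulim\<close> applies both at \<open>p\<close> and at
    \<open>T i p\<close>, the latter being the limit of the successors
    \<open>x (Suc (r k))\<close>.\<close>
  have fixed: "T i p = p"
    if i: "i \<in> {1..m}" and r: "filterlim r at_top sequentially" "(\<lambda>k. x (r k)) \<longlonglongrightarrow> p" "p \<in> W"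
      and app: "\<And>k. x (Suc (r k)) = T i (x (r k))" for i r p
  proof (rule ccontr)
    assume "T i p \<noteq> p"
    moreover have "(\<lambda>k. x (Suc (r k))) \<longlonglongrightarrow> T i p"
      unfolding app using continuous_on_tendsto_compose[OF bspec[OF assms(5) i] r(2,3)] xW by simp
    then have "U (T i p) = c"
      by (intro Ulim[of "\<lambda>k. Suc (r k)"] filterlim_compose[OF filterlim_Suc r(1)] inv i r(3))
    ultimately show False
      using strict[OF i r(3)] Ulim[OF r] by simp
  qed
  \<comment> \<open>Treating one map at a time ensures that a sequence of long steps uses the same
    \<open>T i\<close> throughout, so \<open>fixed\<close> applies to its limit \<open>p\<close>.
    Both ends of these steps then tend to \<open>p\<close>, and their lengths to 0.\<close>
  have stepi: "\<forall>\<^sub>F n in sequentially. x (Suc n) = T i (x n) \<longrightarrow> dist (x (Suc n)) (x n) < e"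
    if i: "i \<in> {1..m}" and e: "e > 0" for i e
  proof (rule ccontr)
    assume "\<not> ?thesis"
    then have "\<exists>\<^sub>F n in sequentially. x (Suc n) = T i (x n) \<and> \<not> dist (x (Suc n)) (x n) < e"
      by (simp only: not_eventually not_imp)
    then obtain p r where p: "p \<in> W" and r: "strict_mono r" "(\<lambda>k. x (r k)) \<longlonglongrightarrow> p"
      and "\<forall>k. x (Suc (r k)) = T i (x (r k)) \<and> \<not> dist (x (Suc (r k))) (x (r k)) < e"
      using frequently_convergent_subseq[OF assms(2) ran] by blast
    then have app: "\<And>k. x (Suc (r k)) = T i (x (r k))"
      and far: "\<And>k. \<not> dist (x (Suc (r k))) (x (r k)) < e"
      by blast+
    have "T i p = p"
      using fixed[OF i filterlim_subseq[OF r(1)] r(2) p app] .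
    moreover have "(\<lambda>k. T i (x (r k))) \<longlonglongrightarrow> T i p"
      using continuous_on_tendsto_compose[OF bspec[OF assms(5) i] r(2) p] xW by simp
    ultimately have "(\<lambda>k. dist (x (Suc (r k))) (x (r k))) \<longlonglongrightarrow> 0"
      using tendsto_dist[OF _ r(2), of "\<lambda>k. T i (x (r k))" p] by (simp add: app)
    then have "\<forall>\<^sub>F k in sequentially. dist (x (Suc (r k))) (x (r k)) < e"
      using e by (rule order_tendstoD)
    then show False
      using far by simp
  qed
  have step: "(\<lambda>n. dist (x (Suc n)) (x n)) \<longlonglongrightarrow> 0"
  proof (rule tendstoI)
    fix e :: real
    assume "e > 0"
    \<comment> \<open>Finitely many eventual bounds hold simultaneously from some time on, and each
      step is made by one of the maps.\<close>
    then have "\<forall>\<^sub>F n in sequentially. \<forall>i\<in>{1..m}. x (Suc n) = T i (x n) \<longrightarrow> dist (x (Suc n)) (x n) < e"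
      by (intro eventually_ball_finite ballI stepi) auto
    then have "\<forall>\<^sub>F n in sequentially. dist (x (Suc n)) (x n) < e"
      by eventually_elim (use evol in blast)
    then show "\<forall>\<^sub>F n in sequentially. dist (dist (x (Suc n)) (x n)) 0 < e"
      by simp
  qed
  let ?S = "(\<Inter>i\<in>{1..m}. fixed_points_in W (T i)) \<inter> {w \<in> W. U w = c}"
  have limit: "p \<in> ?S" if r: "strict_mono r" "(\<lambda>k. x (r k)) \<longlonglongrightarrow> p" for p r
  proof -
    have rt: "filterlim r at_top sequentially"
      using r(1) by (rule filterlim_subseq)
    have pW: "p \<in> W"
      using closed_sequentially[OF compact_imp_closed[OF assms(2)] _ r(2)] xW by simp
    have "T i p = p" if i: "i \<in> {1..m}" for i
    proof -
      obtain n B where n: "strict_mono n" "\<And>k. x (Suc (n k)) = T i (x (n k))"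
        and B: "\<And>k. n (Suc k) - n k \<le> B"
        using assms(7) i by metis
      \<comment> \<open>Each time \<open>r k\<close> is moved forward, by a bounded amount, to a
        time at which \<open>T i\<close> is applied. As steps shrink to 0, the limit
        \<open>p\<close> is unchanged, so \<open>fixed\<close> can be used for this
        \<open>i\<close>.\<close>
      have "\<forall>k. \<exists>l. r k \<le> n l \<and> n l \<le> r k + (n 0 + B)"
        using bounded_gaps_ex[OF n(1) B] by blast
      then obtain \<kappa> where "\<forall>k. r k \<le> n (\<kappa> k) \<and> n (\<kappa> k) \<le> r k + (n 0 + B)"
        by (rule choice[THEN exE])
      then have \<kappa>: "\<And>k. r k \<le> n (\<kappa> k)" "\<And>k. n (\<kappa> k) \<le> r k + (n 0 + B)"
        by blast+
      have "filterlim (\<lambda>k. n (\<kappa> k)) at_top sequentially"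
        using rt by (rule filterlim_at_top_mono) (simp add: \<kappa>(1))
      then show ?thesis
        by (rule fixed[OF i _ tendsto_bounded_perturbation[OF step rt r(2) \<kappa>] pW n(2)])
    qed
    then show ?thesis
      using pW Ulim[OF rt r(2) pW] by (simp add: fixed_points_in_def)
  qed
  \<comment> \<open>The trivial predicate yields some accumulation point of the evolution, which
    witnesses that the target set is nonempty, as \<open>approaches\<close> demands.\<close>
  obtain p r where "strict_mono r" "(\<lambda>k. x (r k)) \<longlonglongrightarrow> p"
    using frequently_convergent_subseq[OF assms(2) ran, of "\<lambda>_. True"]
    by (metis eventually_frequently eventually_True trivial_limit_sequentially)
  then have "?S \<noteq> {}"
    using limit by blast
  moreover have "(\<lambda>n. infdist (x n) ?S) \<longlonglongrightarrow> 0"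
    using assms(2) ran limit by (rule compact_infdist_tendsto_0)
  ultimately show ?thesis
    unfolding approaches_def by blast
qed

end
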